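(* For every positive integer $m$, let $\mathrm{O3}(m)$ denote the number of partitions of $m$ in which no odd part is repeated, the largest part is even, and the largest part appears exactly once; and let $\mathrm{pod}(m)$ denote the number of partitions of $m$ in which no odd part is repeated. Then for all integers $n>2$, \[ \mathrm{O3}(n+2)+\mathrm{O3}(n-1)=\mathrm{pod}(n). \]
   Context: A partition of $m$ is a finite non-increasing sequence of positive integers $\lambda_1\ge \lambda_2\ge\cdots\ge\lambda_k$ with sum $m$; its parts are the $\lambda_i$ and its largest part is $\lambda_1$. "No odd part is repeated" means every odd integer occurs at most once among the parts (even parts may repeat). *)

theory Defs
  imports Main
begin

definition partitions :: "nat \<Rightarrow> nat list set" where
  "partitions m =
     {ps. sorted_wrt (\<ge>) ps \<and> (\<forall>p \<in> set ps. p > 0) \<and> sum_list ps = m}"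

definition no_odd_part_repeated :: "nat list \<Rightarrow> bool" where
  "no_odd_part_repeated ps \<longleftrightarrow> (\<forall>p. odd p \<longrightarrow> count_list ps p \<le> 1)"

definition pod :: "nat \<Rightarrow> nat" where
  "pod m = card {ps \<in> partitions m. no_odd_part_repeated ps}"

(* The largest part of a non-increasing sequence is its head. For m = 0 the only partition
   is [], which has no largest part; the conjunct count_list ps (hd ps) = 1 excludes it. *)
definition O3 :: "nat \<Rightarrow> nat" where
  "O3 m = card {ps \<in> partitions m. no_odd_part_repeated ps \<and>
                  even (hd ps) \<and> count_list ps (hd ps) = 1}"

(* Hence card in pod and O3 counts finite sets only. *)
lemma finite_partitions: "finite (partitions m)"
proof (rule finite_subset)
  have "length ps \<le> sum_list ps" if "\<forall>p \<in> set ps. p > 0" for ps :: "nat list"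
    using that by (induction ps) auto
  then show "partitions m \<subseteq> {ps. set ps \<subseteq> {..m} \<and> length ps \<le> m}"
    by (auto simp: partitions_def intro: member_le_sum_list)
  show "finite {ps. set ps \<subseteq> {..m} \<and> length ps \<le> m}"
    by (rule finite_lists_length_le) simp
qed

end

theory Submission
  imports Defs
begin

text \<open>
  Let \<open>2k\<close> be the largest part of a partition counted by \<open>O3\<close>. Replacing it by \<open>2k + 1\<close> turns
  the partitions of \<open>n - 1\<close> into those partitions counted by \<open>pod n\<close> whose largest part \<open>x\<close> is odd
  with \<open>x - 1\<close> not a part; replacing it by \<open>2k - 2\<close> and reordering (a part \<open>2k - 1\<close> is now the
  largest one) turns the partitions of \<open>n + 2\<close> into the remaining ones. The bound on \<open>n\<close> guarantees
  \<open>k > 1\<close> in the second case, and excludes the partition \<open>[1]\<close>, which the first case misses.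
\<close>

definition pod_partitions :: "nat \<Rightarrow> nat list set" where
  "pod_partitions m = {ps \<in> partitions m. no_odd_part_repeated ps}"

definition O3_partitions :: "nat \<Rightarrow> nat list set" where
  "O3_partitions m = {ps \<in> pod_partitions m. even (hd ps) \<and> count_list ps (hd ps) = 1}"

text \<open>The head is the largest part. For a partition without repeated odd parts, the condition
  says that the head minus one is even and still exceeds every other part.\<close>

definition odd_gap_head :: "nat list \<Rightarrow> bool" where
  "odd_gap_head ps \<longleftrightarrow> odd (hd ps) \<and> (hd ps - 1) \<notin> set (tl ps)"

lemma no_odd_part_repeated_Cons:
  "no_odd_part_repeated (x # xs) \<longleftrightarrow> (odd x \<longrightarrow> x \<notin> set xs) \<and> no_odd_part_repeated xs"
proof -
  have "count_list (x # xs) p \<le> 1 \<longleftrightarrow> (p = x \<longrightarrow> x \<notin> set xs) \<and> count_list xs p \<le> 1" for p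
    by (auto simp: count_list_0_iff)
  then show ?thesis
    unfolding no_odd_part_repeated_def by (simp add: all_conj_distrib imp_conjR)
qed

lemma Nil_in_pod_partitions: "[] \<in> pod_partitions m \<longleftrightarrow> m = 0"
  by (auto simp: pod_partitions_def partitions_def no_odd_part_repeated_def)

text \<open>Peels off the largest part: ordering and non-repetition merge into one bound on the
  tail, strict below an odd head. The conjunct \<open>x \<le> m\<close> keeps \<open>m - x\<close>
  from being truncated.\<close>

lemma Cons_in_pod_partitions:
  "x # xs \<in> pod_partitions m \<longleftrightarrow>
     0 < x \<and> x \<le> m \<and> (\<forall>y \<in> set xs. y \<le> x \<and> (odd x \<longrightarrow> y < x)) \<and> xs \<in> pod_partitions (m - x)"
proof -
  have sum: "x + sum_list xs = m \<longleftrightarrow> x \<le> m \<and> sum_list xs = m - x"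
    by linarith
  have le: "(\<forall>y \<in> set xs. y \<le> x) \<and> (odd x \<longrightarrow> x \<notin> set xs) \<longleftrightarrow>
      (\<forall>y \<in> set xs. y \<le> x \<and> (odd x \<longrightarrow> y < x))"
    by (metis less_irrefl nless_le)
  show ?thesis
    unfolding pod_partitions_def partitions_def mem_Collect_eq no_odd_part_repeated_Cons le[symmetric]
      sorted_wrt.simps list.set ball_simps sum_list.Cons sum
    by argo
qed

lemma Nil_notin_O3_partitions: "[] \<notin> O3_partitions m"
  by (simp add: O3_partitions_def)

lemma Cons_in_O3_partitions:
  "x # xs \<in> O3_partitions m \<longleftrightarrow>
     0 < x \<and> x \<le> m \<and> even x \<and> (\<forall>y \<in> set xs. y < x) \<and> xs \<in> pod_partitions (m - x)"
proof -
  have "(\<forall>y \<in> set xs. y \<le> x) \<and> x \<notin> set xs \<longleftrightarrow> (\<forall>y \<in> set xs. y < x)"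
    by (metis less_imp_le less_irrefl nless_le)
  then show ?thesis
    by (auto simp: O3_partitions_def Cons_in_pod_partitions count_list_0_iff)
qed

lemma finite_pod_partitions: "finite (pod_partitions m)"
  by (simp add: pod_partitions_def finite_partitions)

lemma pod_eq_card: "pod m = card (pod_partitions m)"
  by (simp add: pod_def pod_partitions_def)

lemma O3_eq_card: "O3 m = card (O3_partitions m)"
  by (simp add: O3_def O3_partitions_def pod_partitions_def)

lemma card_odd_gap_head:
  assumes "n > 1"
  shows "card {ps \<in> pod_partitions n. odd_gap_head ps} = O3 (n - 1)"
proof -
  define f g :: "nat list \<Rightarrow> nat list"
    where "f ps = (hd ps - 1) # tl ps" and "g ps = Suc (hd ps) # tl ps" for ps
  let ?A = "{ps \<in> pod_partitions n. odd_gap_head ps}" and ?B = "O3_partitions (n - 1)"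
  have f: "f ps \<in> ?B \<and> g (f ps) = ps" if "ps \<in> ?A" for ps
  proof (cases ps)
    case Nil
    then show ?thesis
      using that assms by (simp add: Nil_in_pod_partitions)
  next
    case (Cons x xs)
    have x: "0 < x" "x \<le> n" "odd x" "x - 1 \<notin> set xs" "\<forall>y \<in> set xs. y < x"
      and xs: "xs \<in> pod_partitions (n - x)"
      using that by (auto simp: Cons Cons_in_pod_partitions odd_gap_head_def)
    have less: "\<forall>y \<in> set xs. y < x - 1"
    proof
      fix y assume "y \<in> set xs"
      with x have "y < x" "y \<noteq> x - 1" by auto
      then show "y < x - 1" by linarith
    qed
    \<comment> \<open>Lowering a head 1 would create a part 0; this occurs only for
      \<open>[1]\<close>, ruled out by \<open>n > 1\<close>.\<close>
    have "x \<noteq> 1"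
    proof
      assume "x = 1"
      with less have "xs = []" by (cases xs) auto
      with xs \<open>x = 1\<close> assms show False by (simp add: Nil_in_pod_partitions)
    qed
    then show ?thesis
      using x xs less by (auto simp: Cons f_def g_def Cons_in_O3_partitions)
  qed
  have g: "g ps \<in> ?A \<and> f (g ps) = ps" if "ps \<in> ?B" for ps
    using that assms
    by (cases ps) (auto simp: f_def g_def Nil_notin_O3_partitions Cons_in_O3_partitions
      Cons_in_pod_partitions odd_gap_head_def less_Suc_eq)
  have "bij_betw f ?A ?B"
    using f g by (intro bij_betw_byWitness[where f' = g]) auto
  then show ?thesis
    by (simp add: O3_eq_card bij_betw_same_card)
qed

text \<open>An even head \<open>x\<close> becomes \<open>x + 2\<close>. An odd head \<open>x\<close>
  is followed by \<open>x - 1\<close>, which is raised to \<open>x + 1\<close> and moved to the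
  front. The inverse separates the cases by whether the largest part minus one occurs.\<close>

lemma card_not_odd_gap_head:
  assumes "n > 1"
  shows "card {ps \<in> pod_partitions n. \<not> odd_gap_head ps} = O3 (n + 2)"
proof -
  define f g :: "nat list \<Rightarrow> nat list"
    where "f ps = (if even (hd ps) then (hd ps + 2) # tl ps
                   else (hd ps + 1) # hd ps # tl (tl ps))"
      and "g ps = (if hd ps - 1 \<in> set (tl ps) then (hd ps - 1) # (hd ps - 2) # tl (tl ps)
                   else (hd ps - 2) # tl ps)" for ps
  let ?A = "{ps \<in> pod_partitions n. \<not> odd_gap_head ps}" and ?B = "O3_partitions (n + 2)"
  have f: "f ps \<in> ?B \<and> g (f ps) = ps" if "ps \<in> ?A" for ps
  proof (cases ps)
    case Nil
    then show ?thesis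
      using that assms by (simp add: Nil_in_pod_partitions)
  next
    case (Cons x xs)
    have x: "0 < x" "x \<le> n" "\<forall>y \<in> set xs. y \<le> x \<and> (odd x \<longrightarrow> y < x)"
      and xs: "xs \<in> pod_partitions (n - x)"
      using that by (auto simp: Cons Cons_in_pod_partitions)
    show ?thesis
    proof (cases "even x")
      case True
      \<comment> \<open>The absence of \<open>x + 1\<close> makes \<open>g\<close> take its second
        branch on the image.\<close>
      moreover have "x + 1 \<notin> set xs" "\<forall>y \<in> set xs. y < x + 2"
        using x by auto
      ultimately show ?thesis
        using x xs by (simp add: Cons f_def g_def Cons_in_O3_partitions)
    next
      case False
      then have mem: "x - 1 \<in> set xs"
        using that by (simp add: Cons odd_gap_head_def)
      then obtain y ys where Cons': "xs = y # ys"
        by (cases xs) auto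
      \<comment> \<open>Strict since \<open>x\<close> is odd; the second bound holds since
        \<open>y\<close> heads a non-increasing list containing \<open>x - 1\<close>.\<close>
      have "y < x" "x - 1 \<le> y"
        using x xs mem False by (auto simp: Cons' Cons_in_pod_partitions)
      then have y: "y = x - 1" by linarith
      have ys: "\<forall>z \<in> set ys. z \<le> x - 1" "ys \<in> pod_partitions (n - x - (x - 1))"
        "0 < x - 1" "x - 1 \<le> n - x"
        using xs by (auto simp: Cons' y Cons_in_pod_partitions)
      \<comment> \<open>Both sides are \<open>n + 1 - 2 * x\<close>, the sum left for
        \<open>ys\<close>; the bounds on \<open>x\<close> prevent truncation.\<close>
      have eq: "n + 2 - (x + 1) - x = n - x - (x - 1)"
        using ys x by linarith
      have "f ps \<in> ?B"
        using ys x False eq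
        by (auto simp: Cons Cons' f_def Cons_in_O3_partitions Cons_in_pod_partitions)
      moreover have "g (f ps) = ps"
        using False x by (simp add: Cons Cons' y f_def g_def)
      ultimately show ?thesis ..
    qed
  qed
  have g: "g ps \<in> ?A \<and> f (g ps) = ps" if "ps \<in> ?B" for ps
  proof (cases ps)
    case Nil
    then show ?thesis
      using that by (simp add: Nil_notin_O3_partitions)
  next
    case (Cons x xs)
    have x: "0 < x" "x \<le> n + 2" "even x" "\<forall>y \<in> set xs. y < x"
      and xs: "xs \<in> pod_partitions (n + 2 - x)"
      using that by (auto simp: Cons Cons_in_O3_partitions)
    \<comment> \<open>Below a head 2 at most one part 1 fits, so \<open>n + 2\<close> would be at
      most 3.\<close>
    have "x \<noteq> 2"
    proof
      assume [simp]: "x = 2"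
      show False
      proof (cases xs)
        case Nil
        with xs assms show False by (simp add: Nil_in_pod_partitions)
      next
        case (Cons y ys)
        with x xs have [simp]: "y = 1" by (auto simp: Cons_in_pod_partitions)
        with xs Cons have "\<forall>z \<in> set ys. z = 0" "ys \<in> pod_partitions (n - 1)"
          by (auto simp: Cons_in_pod_partitions)
        then show False
          using assms by (cases ys) (auto simp: Nil_in_pod_partitions Cons_in_pod_partitions)
      qed
    qed
    then obtain k where k: "x = k + 2" "even k" "0 < k"
      using x that[of "x - 2"] by (cases "x = 1") auto
    show ?thesis
    proof (cases "x - 1 \<in> set xs")
      case True
      then obtain y ys where Cons': "xs = y # ys"
        by (cases xs) auto
      have "y < x" "x - 1 \<le> y"
        using x xs True by (auto simp: Cons' Cons_in_pod_partitions)
      then have y: "y = k + 1" using k by linarith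
      \<comment> \<open>The odd part \<open>k + 1\<close> cannot repeat, so \<open>k\<close> fits
        directly behind it.\<close>
      have ys: "\<forall>z \<in> set ys. z \<le> k" "ys \<in> pod_partitions (n - k - (k + 1))" "k + 1 \<le> n - k"
        using xs k by (auto simp: Cons' y Cons_in_pod_partitions)
      have "g ps \<in> ?A"
        using ys k
        by (auto simp: Cons Cons' y g_def Cons_in_pod_partitions odd_gap_head_def diff_right_commute)
      moreover have "f (g ps) = ps"
        using k by (simp add: Cons Cons' y f_def g_def)
      ultimately show ?thesis ..
    next
      case False
      \<comment> \<open>With \<open>k + 1\<close> absent, the lowered head \<open>k\<close> remains
        largest; being even, it may repeat.\<close>
      have "\<forall>y \<in> set xs. y \<le> k"
      proof
        fix y assume "y \<in> set xs"
        with x False have "y < x" "y \<noteq> x - 1" by auto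
        with k show "y \<le> k" by linarith
      qed
      then show ?thesis
        using x xs k False
        by (auto simp: Cons f_def g_def Cons_in_pod_partitions odd_gap_head_def)
    qed
  qed
  have "bij_betw f ?A ?B"
    using f g by (intro bij_betw_byWitness[where f' = g]) auto
  then show ?thesis
    by (simp add: O3_eq_card bij_betw_same_card)
qed

theorem theorem1p6:
  fixes n :: nat
  assumes "n > 2"
  shows "O3 (n + 2) + O3 (n - 1) = pod n"
proof -
  let ?A = "{ps \<in> pod_partitions n. odd_gap_head ps}"
  let ?B = "{ps \<in> pod_partitions n. \<not> odd_gap_head ps}"
  have "pod_partitions n = ?B \<union> ?A" by blast
  then have "pod n = card (?B \<union> ?A)" by (simp add: pod_eq_card)
  also have "\<dots> = card ?B + card ?A"
    by (rule card_Un_disjoint) (auto simp: finite_pod_partitions)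
  also have "\<dots> = O3 (n + 2) + O3 (n - 1)"
    using assms card_not_odd_gap_head[of n] card_odd_gap_head[of n] by simp
  finally show ?thesis ..
qed

end
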